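(* Let $1<\alpha<2$, $d\in(0,1-\frac1\alpha)$, and let $g:\mathbb{R}\to\mathbb{R}$ be a measurable function such that $g(t)=0$ for all $t<0$ and $|g(t)|\le Ce^{-ct}$ for some constants $C>0$ and $c>0$. Then the FIMA Stable process $$Y_d(t)=\int_{-\infty}^{t}(I_+^dg)(t-x)\,dL_\alpha(x),\qquad t\in\mathbb{R},$$ is well defined (that is, for every $t\in\mathbb{R}$ the integrand $x\mapsto\mathbf 1_{(-\infty,t]}(x)(I_+^dg)(t-x)$ belongs to $L^\alpha(\mathbb{R})$) and the process $\{Y_d(t)\}_{t\in\mathbb{R}}$ is stationary (its finite-dimensional distributions are invariant under time shifts).
   Context: $\{L_\alpha(t)\}_{t\in\mathbb{R}}$ is a symmetric $\alpha$-stable ($S\alpha S$) process with Lebesgue control measure. The stable integral $f\mapsto\int_{\mathbb{R}}f\,dL_\alpha$ is the associated linear map from $L^\alpha(\mathbb{R})$ to random variables, with $\mathbb{E}[\exp\{i\theta\int f\,dL_\alpha\}]=\exp\{-|\theta|^\alpha\int_{\mathbb{R}}|f(x)|^\alpha dx\}$ for $\theta\in\mathbb{R}$; and $\int_{-\infty}^tf\,dL_\alpha$ means $\int_{\mathbb{R}}\mathbf 1_{(-\infty,t]}f\,dL_\alpha$. The left-sided Riemann-Liouville fractional integral is $(I_+^dg)(x)=\frac1{\Gamma(d)}\int_{-\infty}^xg(t)(x-t)^{d-1}dt$. *)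

theory Defs
  imports "HOL-Probability.Probability"
begin

text \<open>Functions with finite \<open>L\<^sup>\<alpha>\<close> norm for Lebesgue measure; functions that agree almost everywhere
  are not identified.\<close>

definition Lspace :: "real \<Rightarrow> (real \<Rightarrow> real) set" where
  "Lspace \<alpha> = {f \<in> borel_measurable lebesgue. integrable lebesgue (\<lambda>x. \<bar>f x\<bar> powr \<alpha>)}"

text \<open>Symmetric \<open>\<alpha>\<close>-stable process with Lebesgue control measure: \<open>L t\<close> is the (signed) random
  measure of the interval between \<open>0\<close> and \<open>t\<close>, so the increment over an interval of length
  \<open>t - s\<close> has scale parameter \<open>(t - s) powr (1/\<alpha>)\<close>, and increments over consecutive intervals
  are independent.\<close>

definition SaS_process :: "'w measure \<Rightarrow> real \<Rightarrow> (real \<Rightarrow> 'w \<Rightarrow> real) \<Rightarrow> bool" where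
  "SaS_process M \<alpha> L \<longleftrightarrow>
     (\<forall>t. L t \<in> borel_measurable M) \<and>
     (AE w in M. L 0 w = 0) \<and>
     (\<forall>(n::nat) t. (\<forall>i<n. t i \<le> t (Suc i)) \<longrightarrow>
        prob_space.indep_vars M (\<lambda>_. borel) (\<lambda>i w. L (t (Suc i)) w - L (t i) w) {..<n}) \<and>
     (\<forall>s t \<theta>. s \<le> t \<longrightarrow>
        char (distr M borel (\<lambda>w. L t w - L s w)) \<theta>
          = complex_of_real (exp (- (\<bar>\<theta>\<bar> powr \<alpha> * (t - s)))))"

text \<open>\<open>I f\<close> is a version of \<open>\<integral>f dL\<close>. Random variables are only determined up to almost sure equality,
  so linearity holds almost surely, with an exceptional set that may depend on \<open>f\<close>, \<open>g\<close>, \<open>a\<close>, \<open>b\<close>.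
  The last clause ties \<open>I\<close> to the given process \<open>L\<close>.\<close>

definition stable_integral ::
    "'w measure \<Rightarrow> real \<Rightarrow> (real \<Rightarrow> 'w \<Rightarrow> real) \<Rightarrow> ((real \<Rightarrow> real) \<Rightarrow> 'w \<Rightarrow> real) \<Rightarrow> bool" where
  "stable_integral M \<alpha> L I \<longleftrightarrow>
     (\<forall>f\<in>Lspace \<alpha>. I f \<in> borel_measurable M) \<and>
     (\<forall>f\<in>Lspace \<alpha>. \<forall>g\<in>Lspace \<alpha>. \<forall>a b.
        AE w in M. I (\<lambda>x. a * f x + b * g x) w = a * I f w + b * I g w) \<and>
     (\<forall>f\<in>Lspace \<alpha>. \<forall>\<theta>.
        char (distr M borel (I f)) \<theta>
          = complex_of_real (exp (- (\<bar>\<theta>\<bar> powr \<alpha> * (LINT x|lebesgue. \<bar>f x\<bar> powr \<alpha>))))) \<and>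
     (\<forall>s t. s \<le> t \<longrightarrow> (AE w in M. I (indicator {s<..t}) w = L t w - L s w))"

definition RL_integrand :: "real \<Rightarrow> (real \<Rightarrow> real) \<Rightarrow> real \<Rightarrow> real \<Rightarrow> real" where
  "RL_integrand d g x t = g t * (x - t) powr (d - 1)"

definition RL_integral :: "real \<Rightarrow> (real \<Rightarrow> real) \<Rightarrow> real \<Rightarrow> real" where
  "RL_integral d g x = 1 / Gamma d * (LINT t:{..x}|lebesgue. RL_integrand d g x t)"

definition FIMA_kernel :: "real \<Rightarrow> (real \<Rightarrow> real) \<Rightarrow> real \<Rightarrow> real \<Rightarrow> real" where
  "FIMA_kernel d g t x = indicator {..t} x * RL_integral d g (t - x)"

definition FIMA ::
    "((real \<Rightarrow> real) \<Rightarrow> 'w \<Rightarrow> real) \<Rightarrow> real \<Rightarrow> (real \<Rightarrow> real) \<Rightarrow> real \<Rightarrow> 'w \<Rightarrow> real" where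
  "FIMA I d g t = I (FIMA_kernel d g t)"

definition stationary_process :: "'w measure \<Rightarrow> (real \<Rightarrow> 'w \<Rightarrow> real) \<Rightarrow> bool" where
  "stationary_process M Y \<longleftrightarrow>
     (\<forall>t. Y t \<in> borel_measurable M) \<and>
     (\<forall>h J. finite J \<longrightarrow>
        distr M (PiM J (\<lambda>_. borel)) (\<lambda>w. \<lambda>t\<in>J. Y (t + h) w)
          = distr M (PiM J (\<lambda>_. borel)) (\<lambda>w. \<lambda>t\<in>J. Y t w))"

end

(* A stable integral is determined in law by the L^alpha norm of its integrand, and a linear
   combination of the Y_d(t_i) is, almost surely, the integral of the same combination of kernels.
   Since the kernels are translates of the single function x |-> (I_+^d g)(-x), shifting time only
   translates that integrand, which leaves its norm, hence the characteristic functions of all linear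
   combinations, unchanged; the Cramer-Wold device concludes.

   The function I_+^d g lies in L^alpha because it vanishes on the negative axis, is bounded near 0,
   and is O(x^(d-1)) at infinity, where (d-1) alpha < -1.  For the decay one splits the convolution
   at t = x/2: there either (x-t)^(d-1) <= (x/2)^(d-1) or exp(-ct) <= exp(-cx/2). *)

theory Submission
  imports Defs
begin

section \<open>Uniqueness of joint laws: the Cramer-Wold device\<close>

text \<open>The hypotheses at \<open>s = 0\<close> say that both weights have the same total mass
  \<open>m\<close>. Divided by \<open>m\<close> they become probability densities, under which
  \<open>X\<close> and \<open>Y\<close> have equal characteristic functions, so Levy uniqueness
  applies. Since weights may contain indicators of earlier coordinates, this one-dimensional fact
  can be iterated to reach joint laws.\<close>

lemma weighted_Levy_uniqueness:
  fixes X U :: "'a \<Rightarrow> real" and Y V :: "'b \<Rightarrow> real"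
  assumes "prob_space M" "prob_space N"
    and [measurable]: "X \<in> borel_measurable M" "U \<in> borel_measurable M"
      "Y \<in> borel_measurable N" "V \<in> borel_measurable N"
    and U: "\<And>w. 0 \<le> U w" "\<And>w. U w \<le> B" and V: "\<And>w. 0 \<le> V w" "\<And>w. V w \<le> B"
    and cos_eq: "\<And>s. (LINT w|M. U w * cos (s * X w)) = (LINT w|N. V w * cos (s * Y w))"
    and sin_eq: "\<And>s. (LINT w|M. U w * sin (s * X w)) = (LINT w|N. V w * sin (s * Y w))"
    and A: "A \<in> sets borel"
  shows "(LINT w|M. U w * indicator A (X w)) = (LINT w|N. V w * indicator A (Y w))"
proof -
  interpret M: prob_space M by fact
  interpret N: prob_space N by fact
  note [measurable] = A
  define m where "m = (LINT w|M. U w)"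
  have m': "m = (LINT w|N. V w)"
    using cos_eq[of 0] by (simp add: m_def)
  have intU: "integrable M U"
    by (rule M.integrable_const_bound[where B=B]) (use U in auto)
  have intV: "integrable N V"
    by (rule N.integrable_const_bound[where B=B]) (use V in auto)
  have m0: "0 \<le> m"
    unfolding m_def by (intro integral_nonneg_AE AE_I2 U)
  show ?thesis
  proof (cases "m = 0")
    \<comment> \<open>No normalisation is possible for zero mass, but then nonnegativity forces both
      weights to vanish almost everywhere.\<close>
    case True
    have "AE w in M. U w = 0" "AE w in N. V w = 0"
      using integral_nonneg_eq_0_iff_AE[OF intU] integral_nonneg_eq_0_iff_AE[OF intV] True m' m_def U V
      by auto
    then have "(LINT w|M. U w * indicator A (X w)) = (LINT w|M. 0)"
      "(LINT w|N. V w * indicator A (Y w)) = (LINT w|N. 0)"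
      by (intro integral_cong_AE; fastforce)+
    then show ?thesis by simp
  next
    case False
    then have m: "m > 0" using m0 by simp
    have real_distr: "real_distribution (distr (density K (\<lambda>w. W w / m)) borel Z)"
      if "prob_space K" and [measurable]: "W \<in> borel_measurable K" "Z \<in> borel_measurable K"
        and W: "\<And>w. 0 \<le> W w" "integrable K W" "m = (LINT w|K. W w)"
      for K :: "'c measure" and W Z :: "'c \<Rightarrow> real"
    proof -
      have "(\<integral>\<^sup>+w. ennreal (W w / m) \<partial>K) = ennreal (LINT w|K. W w / m)"
        by (rule nn_integral_eq_integral) (use W m in auto)
      also have "\<dots> = 1"
        using W m by simp
      finally have "prob_space (density K (\<lambda>w. W w / m))"
        by (intro prob_spaceI) (simp add: emeasure_density cong: nn_integral_cong)
      then interpret D: prob_space "density K (\<lambda>w. W w / m)" .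
      show ?thesis
        by (rule D.real_distribution_distr) simp
    qed
    have char: "char (distr (density K (\<lambda>w. W w / m)) borel Z) s
        = Complex ((LINT w|K. W w * cos (s * Z w)) / m) ((LINT w|K. W w * sin (s * Z w)) / m)"
      if "prob_space K" and [measurable]: "W \<in> borel_measurable K" "Z \<in> borel_measurable K"
        and W: "\<And>w. 0 \<le> W w" "\<And>w. W w \<le> B"
      for K :: "'c measure" and W Z :: "'c \<Rightarrow> real" and s
    proof -
      interpret K: prob_space K by fact
      have Wz: "W w * \<bar>z\<bar> \<le> B" if "\<bar>z\<bar> \<le> 1" for z w
        using mult_mono[OF W(2) that] W[of w] by auto
      have ic: "integrable K (\<lambda>w. W w * cos (s * Z w) / m)"
        by (intro integrable_divide K.integrable_const_bound[where B=B]) (auto simp: abs_mult W intro!: Wz)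
      have isn: "integrable K (\<lambda>w. W w * sin (s * Z w) / m)"
        by (intro integrable_divide K.integrable_const_bound[where B=B]) (auto simp: abs_mult W intro!: Wz)
      have iexp: "iexp x = complex_of_real (cos x) + \<i> * complex_of_real (sin x)" for x
        by (simp add: cis_conv_exp[symmetric] complex_eq_iff)
      have "char (distr (density K (\<lambda>w. W w / m)) borel Z) s
          = (CLINT w|K. complex_of_real (W w / m) * iexp (s * Z w))"
        unfolding char_def using W m
        by (simp add: integral_distr integral_density scaleR_conv_of_real)
      also have "\<dots> = (CLINT w|K. complex_of_real (W w * cos (s * Z w) / m) + \<i> * complex_of_real (W w * sin (s * Z w) / m))"
        by (intro Bochner_Integration.integral_cong refl, subst iexp)
           (simp add: algebra_simps add_divide_distrib)
      also have "\<dots> = complex_of_real (LINT w|K. W w * cos (s * Z w) / m)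
          + \<i> * complex_of_real (LINT w|K. W w * sin (s * Z w) / m)"
        using ic isn by (subst Bochner_Integration.integral_add) (auto simp del: of_real_divide of_real_mult)
      finally show ?thesis
        by (simp add: Complex_eq)
    qed
    have "distr (density M (\<lambda>w. U w / m)) borel X = distr (density N (\<lambda>w. V w / m)) borel Y"
      using assms intU intV m_def m' real_distr[of M U X] real_distr[of N V Y]
        char[of M U X] char[of N V Y]
      by (intro Levy_uniqueness) (auto simp: fun_eq_iff)
    then have "(LINT x|distr (density M (\<lambda>w. U w / m)) borel X. indicator A x :: real)
        = (LINT x|distr (density N (\<lambda>w. V w / m)) borel Y. indicator A x)"
      by simp
    then have "(LINT w|M. U w / m * indicator A (X w)) = (LINT w|N. V w / m * indicator A (Y w))"
      using U V m by (subst (asm) (1 2) integral_distr; simp add: integral_real_density del: integral_indicator)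
    then show ?thesis
      using m by simp
  qed
qed

text \<open>The product-to-sum formula turns an oscillating weight times a test function into
  cosines of a phase plus a single linear form. This is the shape in which the induction in
  \<open>Cramer_Wold\<close> supplies its hypothesis.\<close>

lemma (in prob_space) expectation_cos_weight_mult_cos:
  fixes P T X :: "'a \<Rightarrow> real"
  assumes [measurable]: "P \<in> borel_measurable M" "T \<in> borel_measurable M" "X \<in> borel_measurable M"
    and P: "\<And>w. \<bar>P w\<bar> \<le> 1"
  shows "expectation (\<lambda>w. P w * (1 + cos (\<phi> + T w)) * cos (s * X w - \<psi>))
    = expectation (\<lambda>w. P w * cos (- \<psi> + s * X w))
      + expectation (\<lambda>w. P w * cos ((\<phi> - \<psi>) + (T w + s * X w))) / 2
      + expectation (\<lambda>w. P w * cos ((\<phi> + \<psi>) + (T w + (- s) * X w))) / 2"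
proof -
  have int: "integrable M (\<lambda>w. P w * cos (f w))" if [measurable]: "f \<in> borel_measurable M" for f
    by (rule integrable_const_bound[where B=1])
       (auto simp: abs_mult intro!: mult_le_one P)
  have eq: "P w * (1 + cos (\<phi> + T w)) * cos (s * X w - \<psi>)
      = P w * cos (- \<psi> + s * X w) + (P w * cos ((\<phi> - \<psi>) + (T w + s * X w))) / 2
        + (P w * cos ((\<phi> + \<psi>) + (T w + (- s) * X w))) / 2" for w
    using cos_times_cos[of "\<phi> + T w" "s * X w - \<psi>"]
    by (simp add: algebra_simps add_divide_distrib)
  show ?thesis
    unfolding eq by (simp add: int)
qed

text \<open>The characteristic functions give \<open>E cos (\<phi> + \<Sum>\<^sub>i \<theta>\<^sub>i X\<^sub>i)\<close> for all phases and
  frequencies. Inductively, indicator factors \<open>1\<^sub>A(X\<^sub>j)\<close> are inserted one at a time by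
  one-dimensional Levy uniqueness, applied to the law of \<open>X\<^sub>j\<close> weighted by the earlier indicators
  times \<open>1 + cos (\<dots>)\<close>; the summand 1 keeps this weight nonnegative.\<close>

lemma Cramer_Wold:
  fixes X :: "'i \<Rightarrow> 'a \<Rightarrow> real" and Y :: "'i \<Rightarrow> 'b \<Rightarrow> real"
  assumes "prob_space M" "prob_space N" "finite J"
    and X[measurable]: "\<And>i. X i \<in> borel_measurable M"
    and Y[measurable]: "\<And>i. Y i \<in> borel_measurable N"
    and char_eq: "\<And>\<theta>. char (distr M borel (\<lambda>w. \<Sum>i\<in>J. \<theta> i * X i w)) 1
      = char (distr N borel (\<lambda>w. \<Sum>i\<in>J. \<theta> i * Y i w)) 1"
  shows "distr M (PiM J (\<lambda>_. borel)) (\<lambda>w. \<lambda>i\<in>J. X i w)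
    = distr N (PiM J (\<lambda>_. borel)) (\<lambda>w. \<lambda>i\<in>J. Y i w)"
proof -
  interpret M: prob_space M by fact
  interpret N: prob_space N by fact
  \<comment> \<open>Real and imaginary parts at frequency 1 give every phase by the addition
    formula. Other frequencies are absorbed into the coefficients \<theta>, which are arbitrary in
    \<open>char_eq\<close>.\<close>
  have trig: "(LINT w|K. cos (\<phi> + f w)) = cos \<phi> * Re (char (distr K borel f) 1) - sin \<phi> * Im (char (distr K borel f) 1)"
    if "prob_space K" and [measurable]: "f \<in> borel_measurable K" for K :: "'c measure" and f \<phi>
  proof -
    interpret K: prob_space K by fact
    have int: "integrable K (\<lambda>w. iexp (f w))"
      by (rule K.integrable_const_bound[where B=1]) auto
    have "char (distr K borel f) 1 = (CLINT w|K. iexp (f w))"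
      by (simp add: char_def integral_distr)
    then have "Re (char (distr K borel f) 1) = (LINT w|K. cos (f w))"
      "Im (char (distr K borel f) 1) = (LINT w|K. sin (f w))"
      using int by (simp_all add: integral_Re[symmetric] integral_Im[symmetric] Re_exp Im_exp del: integral_Re integral_Im)
    moreover have "integrable K (\<lambda>w. cos (f w))" "integrable K (\<lambda>w. sin (f w))"
      by (rule K.integrable_const_bound[where B=1]; simp)+
    ultimately show ?thesis
      by (simp add: cos_add)
  qed
  \<comment> \<open>Adding \<open>s\<close> times coordinate \<open>j\<close> only changes one
    coefficient of the linear form, so an induction hypothesis valid for all \<theta> already covers
    it.\<close>
  have shift: "(\<Sum>i\<in>J. (\<theta>(j := \<theta> j + s)) i * Z i) = (\<Sum>i\<in>J. \<theta> i * Z i) + s * Z j"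
    if "j \<in> J" for \<theta> Z :: "'i \<Rightarrow> real" and j s
    using that \<open>finite J\<close> by (simp add: sum.remove algebra_simps)
  have main: "(LINT w|M. (\<Prod>i\<in>S. indicator (A i) (X i w)) * cos (\<phi> + (\<Sum>i\<in>J. \<theta> i * X i w)))
      = (LINT w|N. (\<Prod>i\<in>S. indicator (A i) (Y i w)) * cos (\<phi> + (\<Sum>i\<in>J. \<theta> i * Y i w)))"
    if "S \<subseteq> J" and A[measurable]: "\<And>i. A i \<in> sets borel" for S A \<theta> \<phi>
  proof -
    have "finite S" using that \<open>finite J\<close> finite_subset by blast
    then show ?thesis using \<open>S \<subseteq> J\<close>
    proof (induction S arbitrary: \<theta> \<phi> rule: finite_induct)
      case empty
      show ?case
        using trig[OF \<open>prob_space M\<close>, of "\<lambda>w. \<Sum>i\<in>J. \<theta> i * X i w" \<phi>]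
          trig[OF \<open>prob_space N\<close>, of "\<lambda>w. \<Sum>i\<in>J. \<theta> i * Y i w" \<phi>] char_eq[of \<theta>]
        by simp
    next
      case (insert j S)
      then have j: "j \<in> J" and IH: "\<And>\<theta> \<phi>. (LINT w|M. (\<Prod>i\<in>S. indicator (A i) (X i w)) * cos (\<phi> + (\<Sum>i\<in>J. \<theta> i * X i w)))
        = (LINT w|N. (\<Prod>i\<in>S. indicator (A i) (Y i w)) * cos (\<phi> + (\<Sum>i\<in>J. \<theta> i * Y i w)))"
        by auto
      define P where "P w = (\<Prod>i\<in>S. indicator (A i) (X i w) :: real)" for w
      define Q where "Q w = (\<Prod>i\<in>S. indicator (A i) (Y i w) :: real)" for w
      have [measurable]: "P \<in> borel_measurable M" "Q \<in> borel_measurable N"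
        unfolding P_def Q_def by measurable
      have P: "0 \<le> P w" "P w \<le> 1" for w
        unfolding P_def by (auto intro!: prod_nonneg prod_le_1)
      have Q: "0 \<le> Q w" "Q w \<le> 1" for w
        unfolding Q_def by (auto intro!: prod_nonneg prod_le_1)
      have IH': "(LINT w|M. P w * cos (\<phi> + ((\<Sum>i\<in>J. \<theta> i * X i w) + s * X j w)))
          = (LINT w|N. Q w * cos (\<phi> + ((\<Sum>i\<in>J. \<theta> i * Y i w) + s * Y j w)))" for \<phi> \<theta> s
        using IH[of \<phi> "\<theta>(j := \<theta> j + s)"]
        unfolding P_def Q_def shift[OF j, of \<theta> s "\<lambda>i. X i w" for w] shift[OF j, of \<theta> s "\<lambda>i. Y i w" for w] .
      have weighted: "(LINT w|M. P w * (1 + cos (\<phi> + (\<Sum>i\<in>J. \<theta> i * X i w))) * indicator (A j) (X j w))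
          = (LINT w|N. Q w * (1 + cos (\<phi> + (\<Sum>i\<in>J. \<theta> i * Y i w))) * indicator (A j) (Y j w))" for \<phi> \<theta>
      proof -
        have cos_eq: "(LINT w|M. P w * (1 + cos (\<phi> + (\<Sum>i\<in>J. \<theta> i * X i w))) * cos (s * X j w - \<psi>))
          = (LINT w|N. Q w * (1 + cos (\<phi> + (\<Sum>i\<in>J. \<theta> i * Y i w))) * cos (s * Y j w - \<psi>))" for s \<psi>
          using P Q IH'[of "- \<psi>" "\<lambda>_. 0" s] IH'[of "\<phi> - \<psi>" \<theta> s] IH'[of "\<phi> + \<psi>" \<theta> "- s"]
          by (subst M.expectation_cos_weight_mult_cos, simp_all,
              subst N.expectation_cos_weight_mult_cos, simp_all)
        have bd: "0 \<le> 1 + cos x" "1 + cos x \<le> 2" for x :: real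
          using cos_ge_minus_one[of x] cos_le_one[of x] by linarith+
        have bd2: "p * (1 + cos x) \<le> 2" if "0 \<le> p" "p \<le> 1" for p x :: real
          using mult_mono[OF that(2) bd(2)[of x]] bd(1)[of x] that by auto
        show ?thesis
        proof (rule weighted_Levy_uniqueness[where B=2])
          fix s
          show "(LINT w|M. P w * (1 + cos (\<phi> + (\<Sum>i\<in>J. \<theta> i * X i w))) * cos (s * X j w)) =
            (LINT w|N. Q w * (1 + cos (\<phi> + (\<Sum>i\<in>J. \<theta> i * Y i w))) * cos (s * Y j w))"
            using cos_eq[of s 0] by simp
          show "(LINT w|M. P w * (1 + cos (\<phi> + (\<Sum>i\<in>J. \<theta> i * X i w))) * sin (s * X j w)) =
            (LINT w|N. Q w * (1 + cos (\<phi> + (\<Sum>i\<in>J. \<theta> i * Y i w))) * sin (s * Y j w))"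
            \<comment> \<open>The phase pi/2 turns the cosine test function into a sine.\<close>
            using cos_eq[of s "pi/2"] by (simp add: cos_diff)
        qed (use P Q bd bd2 in \<open>auto intro!: mult_nonneg_nonneg \<open>prob_space M\<close> \<open>prob_space N\<close>\<close>)
      qed
      \<comment> \<open>With zero phase and zero coefficients the weight is \<open>2 * P\<close>,
        which yields the identity for \<open>P\<close> alone. Subtracting it from
        \<open>weighted\<close> removes the summand 1 that had been added for positivity and leaves
        the pure cosine term.\<close>
      have "(LINT w|M. P w * (1 + cos (0 + (\<Sum>i\<in>J. 0 * X i w))) * indicator (A j) (X j w))
          = (LINT w|N. Q w * (1 + cos (0 + (\<Sum>i\<in>J. 0 * Y i w))) * indicator (A j) (Y j w))"
        by (rule weighted)
      then have flat: "(LINT w|M. P w * indicator (A j) (X j w)) = (LINT w|N. Q w * indicator (A j) (Y j w))"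
        by (simp add: mult.assoc mult.left_commute[of _ 2] del: mult_numeral_left)
      have split: "(LINT w|K. R w * (1 + cos (f w)) * indicator (A j) (Z w))
          = (LINT w|K. R w * indicator (A j) (Z w)) + (LINT w|K. indicator (A j) (Z w) * R w * cos (f w))"
        if "prob_space K" and [measurable]: "R \<in> borel_measurable K" "f \<in> borel_measurable K" "Z \<in> borel_measurable K"
          and R: "\<And>w. 0 \<le> R w" "\<And>w. R w \<le> 1" for K :: "'c measure" and R f Z :: "'c \<Rightarrow> real"
      proof -
        interpret K: prob_space K by fact
        have "integrable K (\<lambda>w. R w * indicator (A j) (Z w))"
          by (rule K.integrable_const_bound[where B=1]) (use R in \<open>auto simp: indicator_def\<close>)
        moreover have "integrable K (\<lambda>w. indicator (A j) (Z w) * R w * cos (f w))"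
          by (rule K.integrable_const_bound[where B=1])
             (use R in \<open>auto simp: abs_mult indicator_def intro!: mult_le_one\<close>)
        ultimately show ?thesis
          by (subst Bochner_Integration.integral_add[symmetric])
             (auto intro!: Bochner_Integration.integral_cong simp: algebra_simps)
      qed
      have "(LINT w|M. indicator (A j) (X j w) * P w * cos (\<phi> + (\<Sum>i\<in>J. \<theta> i * X i w)))
          = (LINT w|N. indicator (A j) (Y j w) * Q w * cos (\<phi> + (\<Sum>i\<in>J. \<theta> i * Y i w)))"
        using weighted[of \<phi> \<theta>] flat P Q
          split[OF \<open>prob_space M\<close>, of P "\<lambda>w. \<phi> + (\<Sum>i\<in>J. \<theta> i * X i w)" "X j"]
          split[OF \<open>prob_space N\<close>, of Q "\<lambda>w. \<phi> + (\<Sum>i\<in>J. \<theta> i * Y i w)" "Y j"]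
        by simp
      then show ?case
        using insert.hyps unfolding P_def Q_def by simp
    qed
  qed
  have emb: "emeasure (distr K (PiM J (\<lambda>_. borel)) (\<lambda>w. \<lambda>i\<in>J. Z i w)) (prod_emb J (\<lambda>_. borel) S (Pi\<^sub>E S A))
      = ennreal (LINT w|K. (\<Prod>i\<in>S. indicator (A i) (Z i w)))"
    if "prob_space K" and [measurable]: "\<And>i. Z i \<in> borel_measurable K"
      and "S \<subseteq> J" "finite S" and A[measurable]: "\<And>i. i \<in> S \<Longrightarrow> A i \<in> sets borel"
    for K :: "'c measure" and Z :: "'i \<Rightarrow> 'c \<Rightarrow> real" and S A
  proof -
    interpret K: prob_space K by fact
    define E where "E = {w \<in> space K. \<forall>i\<in>S. Z i w \<in> A i}"
    have [measurable]: "E \<in> sets K"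
      unfolding E_def using \<open>finite S\<close> by measurable
    have "emeasure (distr K (PiM J (\<lambda>_. borel)) (\<lambda>w. \<lambda>i\<in>J. Z i w)) (prod_emb J (\<lambda>_. borel) S (Pi\<^sub>E S A))
      = emeasure K ((\<lambda>w. \<lambda>i\<in>J. Z i w) -` (prod_emb J (\<lambda>_. borel) S (Pi\<^sub>E S A)) \<inter> space K)"
      using that by (intro emeasure_distr sets_PiM_I) auto
    also have "(\<lambda>w. \<lambda>i\<in>J. Z i w) -` (prod_emb J (\<lambda>_. borel) S (Pi\<^sub>E S A)) \<inter> space K = E"
      using \<open>S \<subseteq> J\<close> unfolding E_def by (auto simp: prod_emb_def PiE_iff extensional_def subset_iff)
    also have "emeasure K E = ennreal (LINT w|K. indicator E w)"
      by (simp add: K.emeasure_eq_measure)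
    also have "(LINT w|K. indicator E w) = (LINT w|K. (\<Prod>i\<in>S. indicator (A i) (Z i w)) :: real)"
      using \<open>finite S\<close> by (intro Bochner_Integration.integral_cong refl) (auto simp: E_def indicator_def)
    finally show ?thesis .
  qed
  show ?thesis
  \<comment> \<open>Finite measures on the product space are determined by their values on cylinder
    sets, and \<open>emb\<close> writes these values as expectations of products of
    indicators.\<close>
  proof (rule measure_eqI_PiM_infinite)
    fix A S assume S: "finite S" "S \<subseteq> J" and A: "\<And>i. i \<in> S \<Longrightarrow> A i \<in> sets (borel :: real measure)"
    have "(LINT w|M. (\<Prod>i\<in>S. indicator (A i) (X i w)) :: real) = (LINT w|N. (\<Prod>i\<in>S. indicator (A i) (Y i w)))"
      \<comment> \<open>Phase and coefficients are zero, so the cosine is 1. The sets are extended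
        by the empty set outside \<open>S\<close> because \<open>main\<close> asks for a Borel set
        at every index.\<close>
      using main[OF S(2), of "\<lambda>i. if i \<in> S then A i else {}" 0 "\<lambda>_. 0"] A
      by (simp cong: prod.cong)
    then show "emeasure (distr M (PiM J (\<lambda>_. borel)) (\<lambda>w. \<lambda>i\<in>J. X i w)) (prod_emb J (\<lambda>_. borel) S (Pi\<^sub>E S A))
      = emeasure (distr N (PiM J (\<lambda>_. borel)) (\<lambda>w. \<lambda>i\<in>J. Y i w)) (prod_emb J (\<lambda>_. borel) S (Pi\<^sub>E S A))"
      using emb[OF \<open>prob_space M\<close> X S(2,1) A] emb[OF \<open>prob_space N\<close> Y S(2,1) A] by simp
  next
    have "(\<lambda>w. \<lambda>i\<in>J. X i w) \<in> measurable M (PiM J (\<lambda>_. borel))"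
      by measurable
    then show "finite_measure (distr M (PiM J (\<lambda>_. borel)) (\<lambda>w. \<lambda>i\<in>J. X i w))"
      by (rule M.finite_measure_distr)
  qed auto
qed

section \<open>Size and integrability of the fractional integral\<close>

text \<open>A nonnegative gauge integrable function is absolutely integrable. This carries the known
  gauge integrals of powers and exponentials over to the Lebesgue integral.\<close>

lemma has_bochner_integral_lebesgue_nonneg:
  fixes f :: "real \<Rightarrow> real"
  assumes "(f has_integral I) S" "\<And>x. x \<in> S \<Longrightarrow> 0 \<le> f x"
  shows "has_bochner_integral lebesgue (\<lambda>x. indicator S x * f x) I"
proof -
  have "f absolutely_integrable_on S"
    using assms by (intro nonnegative_absolutely_integrable_1) auto
  then show ?thesis
    using set_lebesgue_integral_eq_integral(2)[of S f] integral_unique[OF assms(1)]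
    by (simp add: has_bochner_integral_iff set_integrable_def set_lebesgue_integral_def)
qed

lemma has_bochner_integral_reversed_powr:
  fixes d x :: real
  assumes "0 < d" "0 \<le> x"
  shows "has_bochner_integral lebesgue (\<lambda>t. indicator {0..x} t * (x - t) powr (d - 1)) (x powr d / d)"
proof -
  have "has_bochner_integral lebesgue (\<lambda>t. indicator {0..x} t * t powr (d - 1)) (x powr d / d)"
    using has_integral_powr_from_0[of "d - 1" x] assms by (intro has_bochner_integral_lebesgue_nonneg) auto
  \<comment> \<open>The reflection of \<open>t\<close> to \<open>x - t\<close> preserves Lebesgue
    measure and maps the interval from 0 to \<open>x\<close> onto itself.\<close>
  then have "has_bochner_integral lebesgue
      (\<lambda>t. indicator {0..x} (x + -1 * t) * (x + -1 * t) powr (d - 1)) ((x powr d / d) /\<^sub>R \<bar>-1\<bar>)"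
    by (subst has_bochner_integral_lebesgue_real_affine_iff[symmetric]) auto
  moreover have "indicator {0..x} (x + -1 * t) = (indicator {0..x} t :: real)" for t
    by (auto simp: indicator_def)
  ultimately show ?thesis by simp
qed

lemma has_bochner_integral_exp_decay:
  fixes c :: real
  assumes "0 < c"
  shows "has_bochner_integral lebesgue (\<lambda>t. indicator {0..} t * exp (- c * t)) (1 / c)"
  using has_integral_exp_minus_to_infinity[OF assms, of 0]
  by (intro has_bochner_integral_lebesgue_nonneg) auto

lemma RL_integrand_measurable:
  assumes "g \<in> borel_measurable lebesgue"
  shows "(\<lambda>t. indicator {..x} t * RL_integrand d g x t) \<in> borel_measurable lebesgue"
proof -
  have "(\<lambda>t. indicator {..x} t *\<^sub>R ((x - t) powr (d - 1))) \<in> borel_measurable borel"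
    by measurable
  from borel_measurable_times[OF assms measurable_completion[OF this[folded measurable_lborel2]]]
  show ?thesis
    by (simp add: RL_integrand_def mult_ac)
qed

text \<open>Measurability of a parameter integral needs a jointly measurable integrand, while
  \<open>g\<close> is only Lebesgue measurable. Replacing \<open>g\<close> by an almost everywhere
  equal Borel function changes none of the integrals. The Borel conclusion makes the later
  composition with \<open>t - x\<close> measurable.\<close>

lemma RL_integral_measurable:
  assumes "g \<in> borel_measurable lebesgue"
  shows "RL_integral d g \<in> borel_measurable borel"
proof -
  obtain g' where g'[measurable]: "g' \<in> borel_measurable borel" and ae: "AE t in lborel. g t = g' t"
    using completion_ex_borel_measurable_real[OF assms] by auto
  have "RL_integral d g x
      = 1 / Gamma d * (LINT t|lborel. (if t \<le> x then g' t * (x - t) powr (d - 1) else 0))" for x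
  proof -
    have "(LINT t:{..x}|lebesgue. RL_integrand d g x t)
        = (LINT t|lebesgue. (if t \<le> x then g' t * (x - t) powr (d - 1) else 0))"
      unfolding set_lebesgue_integral_def
    proof (rule integral_cong_AE)
      show "(\<lambda>t. indicator {..x} t *\<^sub>R RL_integrand d g x t) \<in> borel_measurable lebesgue"
        using RL_integrand_measurable[OF assms] by simp
      show "(\<lambda>t. if t \<le> x then g' t * (x - t) powr (d - 1) else 0) \<in> borel_measurable lebesgue"
        by (intro measurable_completion) measurable
      show "AE t in lebesgue. indicator {..x} t *\<^sub>R RL_integrand d g x t
          = (if t \<le> x then g' t * (x - t) powr (d - 1) else 0)"
        using AE_completion[OF ae] by eventually_elim (auto simp: RL_integrand_def)
    qed
    also have "\<dots> = (LINT t|lborel. (if t \<le> x then g' t * (x - t) powr (d - 1) else 0))"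
      by (rule integral_completion) measurable
    finally show ?thesis
      by (simp add: RL_integral_def)
  qed
  moreover have "(\<lambda>x. 1 / Gamma d * (LINT t|lborel. (if t \<le> x then g' t * (x - t) powr (d - 1) else 0)))
      \<in> borel_measurable borel"
    by measurable
  ultimately show ?thesis
    by (simp cong: measurable_cong)
qed

lemma RL_integrand_abs_le:
  assumes "\<And>t. t < 0 \<Longrightarrow> g t = 0" and "\<And>t. \<bar>g t\<bar> \<le> C * exp (- c * t)"
  shows "\<bar>indicator {..x} t * RL_integrand d g x t\<bar>
    \<le> C * (indicator {0..x} t * (exp (- c * t) * (x - t) powr (d - 1)))"
  using assms(1)[of t] mult_right_mono[OF assms(2)[of t], of "(x - t) powr (d - 1)"]
  by (auto simp: indicator_def RL_integrand_def abs_mult mult_ac)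

text \<open>Integrability and both size bounds come from integrating majorants of
  \<open>RL_integrand_abs_le\<close>. Bounding the exponential by 1 leaves a power with integral
  \<open>x powr d / d\<close>; keeping half of the exponential decay gains one power of
  \<open>x\<close> for the far bound.\<close>

lemma
  assumes "0 < d" "d \<le> 1" and g[measurable]: "g \<in> borel_measurable lebesgue"
    and g0: "\<And>t. t < 0 \<Longrightarrow> g t = 0" and "0 < C" "0 < c"
    and g_le: "\<And>t. \<bar>g t\<bar> \<le> C * exp (- c * t)"
  shows RL_integrand_integrable: "set_integrable lebesgue {..x} (RL_integrand d g x)"
    and RL_integral_nonpos: "x \<le> 0 \<Longrightarrow> RL_integral d g x = 0"
    and RL_integral_abs_le_near: "0 < x \<Longrightarrow> \<bar>RL_integral d g x\<bar> \<le> C * x powr d / (d * Gamma d)"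
    and RL_integral_abs_le_far: "1 \<le> x \<Longrightarrow> \<bar>RL_integral d g x\<bar>
      \<le> C * ((1/2) powr (d - 1) / c + 2 / (c * d)) / Gamma d * x powr (d - 1)"
proof -
  let ?f = "\<lambda>x t. indicator {..x} t * RL_integrand d g x t"
  let ?p = "\<lambda>x t. indicator {0..x} t * (x - t) powr (d - 1)"
  let ?e = "\<lambda>t. indicator {0..} t * exp (- c * t)"
  have Gamma: "0 < Gamma d" using \<open>0 < d\<close> by (rule Gamma_real_pos)
  have [measurable]: "?f x \<in> borel_measurable lebesgue" for x
    by (rule RL_integrand_measurable[OF g])
  \<comment> \<open>For \<open>x < 0\<close> the support is empty. At \<open>x = t = 0\<close> the
    integrand vanishes because \<open>0 powr (d - 1)\<close> is 0 by convention.\<close>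
  have zero: "?f x t = 0" if "x \<le> 0" for x t
    using RL_integrand_abs_le[OF g0 g_le, of x t d] that
    by (cases "t = 0 \<and> x = 0") (auto simp: indicator_def RL_integrand_def split: if_splits)
  have le_p: "\<bar>?f x t\<bar> \<le> C * ?p x t" for x t
  proof -
    have "exp (- c * t) * (x - t) powr (d - 1) \<le> 1 * (x - t) powr (d - 1)" if "0 \<le> t"
      using that \<open>0 < c\<close> by (intro mult_right_mono) auto
    then have "indicator {0..x} t * (exp (- c * t) * (x - t) powr (d - 1)) \<le> ?p x t"
      by (auto simp: indicator_def)
    then show ?thesis
      using RL_integrand_abs_le[OF g0 g_le, of x t d] \<open>0 < C\<close> by (meson mult_left_mono order.trans less_imp_le)
  qed
  have int: "integrable lebesgue (?f x)" for x
  proof (cases "x \<le> 0")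
    case False
    then have "integrable lebesgue (\<lambda>t. C * ?p x t)"
      using has_bochner_integral_reversed_powr[OF \<open>0 < d\<close>, of x]
      by (intro integrable_mult_right) (simp add: has_bochner_integral_iff)
    then show ?thesis
      by (rule Bochner_Integration.integrable_bound) (auto intro!: AE_I2 order.trans[OF le_p] abs_ge_self simp del: abs_mult)
  qed (simp add: zero)
  then show "set_integrable lebesgue {..x} (RL_integrand d g x)"
    by (simp add: set_integrable_def)
  show "RL_integral d g x = 0" if "x \<le> 0"
    unfolding RL_integral_def set_lebesgue_integral_def real_scaleR_def zero[OF that] by simp
  have RL_le: "\<bar>RL_integral d g x\<bar> \<le> i / Gamma d"
    if "has_bochner_integral lebesgue h i" "\<And>t. \<bar>?f x t\<bar> \<le> h t" for x h i
  proof -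
    have "\<bar>LINT t|lebesgue. ?f x t\<bar> \<le> (LINT t|lebesgue. \<bar>?f x t\<bar>)"
      by (rule integral_abs_bound)
    also have "\<dots> \<le> (LINT t|lebesgue. h t)"
      using that int[of x] by (intro integral_mono integrable_abs) (auto simp: has_bochner_integral_iff)
    also have "\<dots> = i"
      using that by (simp add: has_bochner_integral_iff)
    finally show ?thesis
      using Gamma by (simp add: RL_integral_def set_lebesgue_integral_def abs_mult divide_simps)
  qed
  show "\<bar>RL_integral d g x\<bar> \<le> C * x powr d / (d * Gamma d)" if "0 < x"
    using RL_le[OF has_bochner_integral_mult_right[OF has_bochner_integral_reversed_powr[OF \<open>0 < d\<close>]] le_p, of x] that
    by (simp add: mult_ac)
  show "\<bar>RL_integral d g x\<bar> \<le> C * ((1/2) powr (d - 1) / c + 2 / (c * d)) / Gamma d * x powr (d - 1)"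
    if "1 \<le> x"
  proof -
    \<comment> \<open>The sum of the bounds for the two halves is a single majorant valid on the
      whole interval, so no integral has to be split.\<close>
    have le_far: "\<bar>?f x t\<bar> \<le> C * ((x / 2) powr (d - 1) * ?e t + exp (- c * x / 2) * ?p x t)" for t
    proof -
      have "exp (- c * t) * (x - t) powr (d - 1)
          \<le> (x / 2) powr (d - 1) * exp (- c * t) + exp (- c * x / 2) * (x - t) powr (d - 1)"
        if "0 \<le> t" "t \<le> x"
      proof (cases "t \<le> x / 2")
        case True
        then have "(x - t) powr (d - 1) \<le> (x / 2) powr (d - 1)"
          using \<open>d \<le> 1\<close> \<open>1 \<le> x\<close> by (intro powr_mono2') auto
        then have "exp (- c * t) * (x - t) powr (d - 1) \<le> exp (- c * t) * (x / 2) powr (d - 1)"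
          by (intro mult_left_mono) auto
        then show ?thesis
          by (simp add: mult.commute add_increasing2)
      next
        case False
        then have "exp (- c * t) \<le> exp (- c * x / 2)"
          using \<open>0 < c\<close> by simp
        then have "exp (- c * t) * (x - t) powr (d - 1) \<le> exp (- c * x / 2) * (x - t) powr (d - 1)"
          by (intro mult_right_mono) auto
        then show ?thesis
          by (simp add: add_increasing)
      qed
      then have "indicator {0..x} t * (exp (- c * t) * (x - t) powr (d - 1))
          \<le> (x / 2) powr (d - 1) * ?e t + exp (- c * x / 2) * ?p x t"
        by (auto simp: indicator_def)
      then show ?thesis
        using RL_integrand_abs_le[OF g0 g_le, of x t d] \<open>0 < C\<close> by (meson mult_left_mono order.trans less_imp_le)
    qed
    have "\<bar>RL_integral d g x\<bar>
        \<le> C * ((x / 2) powr (d - 1) * (1 / c) + exp (- c * x / 2) * (x powr d / d)) / Gamma d"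
      using that \<open>0 < c\<close> \<open>0 < d\<close>
      by (intro RL_le[OF _ le_far] has_bochner_integral_mult_right has_bochner_integral_add
          has_bochner_integral_reversed_powr has_bochner_integral_exp_decay) auto
    also have "(x / 2) powr (d - 1) * (1 / c) = x powr (d - 1) * ((1/2) powr (d - 1) / c)"
      using powr_mult[of x "1/2" "d - 1"] that by simp
    \<comment> \<open>Write \<open>x powr d\<close> as \<open>x powr (d - 1) * x\<close>. The
      inequality \<open>y * exp (- y) \<le> 1\<close> at \<open>y = c * x / 2\<close> bounds the
      remaining factor \<open>x * exp (- c * x / 2)\<close> by \<open>2 / c\<close>.\<close>
    also have "exp (- c * x / 2) * (x powr d / d) \<le> x powr (d - 1) * (2 / (c * d))"
    proof -
      have "c * x / 2 \<le> exp (c * x / 2)"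
        using exp_ge_add_one_self[of "c * x / 2"] by linarith
      then have "c * x / 2 * exp (- (c * x / 2)) \<le> exp (c * x / 2) * exp (- (c * x / 2))"
        by (rule mult_right_mono) simp
      then have "x * exp (- c * x / 2) \<le> 2 / c"
        using \<open>0 < c\<close> by (simp add: exp_minus field_simps)
      then have "x powr (d - 1) / d * (x * exp (- c * x / 2)) \<le> x powr (d - 1) / d * (2 / c)"
        using \<open>0 < d\<close> by (intro mult_left_mono) auto
      moreover have "x powr d = x powr (d - 1) * x"
        using that powr_add[of x "d - 1" 1] by simp
      ultimately show ?thesis
        by (simp add: mult_ac)
    qed
    finally show ?thesis
      using \<open>0 < C\<close> Gamma by (simp add: algebra_simps divide_right_mono)
  qed
qed

lemma RL_integral_powr_integrable:
  assumes "0 < \<alpha>" "0 < d" "d < 1 - 1 / \<alpha>" and g: "g \<in> borel_measurable lebesgue"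
    and g0: "\<And>t. t < 0 \<Longrightarrow> g t = 0" and C: "0 < C" "0 < c"
    and g_le: "\<And>t. \<bar>g t\<bar> \<le> C * exp (- c * t)"
  shows "integrable lebesgue (\<lambda>x. \<bar>RL_integral d g x\<bar> powr \<alpha>)"
proof -
  have "0 < 1 / \<alpha>" using \<open>0 < \<alpha>\<close> by simp
  with assms have "d \<le> 1" by linarith
  have nonpos: "RL_integral d g x = 0" if "x \<le> 0" for x
    by (rule RL_integral_nonpos[where C = C and c = c]) (fact | rule assms)+
  have near: "\<bar>RL_integral d g x\<bar> \<le> C * x powr d / (d * Gamma d)" if "0 < x" for x
    by (rule RL_integral_abs_le_near[where C = C and c = c]) (fact | rule assms)+
  have far: "\<bar>RL_integral d g x\<bar> \<le> C * ((1/2) powr (d - 1) / c + 2 / (c * d)) / Gamma d * x powr (d - 1)"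
    if "1 \<le> x" for x
    by (rule RL_integral_abs_le_far[where C = C and c = c]) (fact | rule assms)+
  have Gamma: "0 < Gamma d" using \<open>0 < d\<close> by (rule Gamma_real_pos)
  note [measurable] = RL_integral_measurable[OF g, of d]
  define K where "K = C / (d * Gamma d)"
  define K' where "K' = C * ((1/2) powr (d - 1) / c + 2 / (c * d)) / Gamma d"
  have K: "0 \<le> K" "0 \<le> K'"
    using C \<open>0 < d\<close> Gamma by (auto simp: K_def K'_def)
  \<comment> \<open>The majorant is constant on the unit interval, where
    \<open>x powr d \<le> 1\<close>, and a pure power beyond it.\<close>
  define h where "h x = K powr \<alpha> * indicator {0..1} x
    + K' powr \<alpha> * (indicator {1..} x * x powr ((d - 1) * \<alpha>))" for x :: real
  \<comment> \<open>For positive \<alpha> this is equivalent to the upper bound on \<open>d\<close>;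
    it makes the power tail integrable.\<close>
  have "(d - 1) * \<alpha> < - 1"
    using assms(1,3) by (simp add: field_simps)
  then have "integrable lebesgue (\<lambda>x. indicator {1..} x * x powr ((d - 1) * \<alpha>))"
    using has_bochner_integral_lebesgue_nonneg[OF has_integral_powr_to_inf[of "(d - 1) * \<alpha>" 1]]
    by (auto simp: has_bochner_integral_iff)
  then have h: "integrable lebesgue h"
    unfolding h_def by (intro Bochner_Integration.integrable_add integrable_mult_right) simp_all
  show ?thesis
  proof (rule Bochner_Integration.integrable_bound[OF h])
    show "(\<lambda>x. \<bar>RL_integral d g x\<bar> powr \<alpha>) \<in> borel_measurable lebesgue"
      by (rule measurable_completion) measurable
    have "\<bar>RL_integral d g x\<bar> powr \<alpha> \<le> h x" for x
    proof -
      consider "x \<le> 0" | "0 < x" "x < 1" | "1 \<le> x" by linarith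
      then show ?thesis
      proof cases
        case 1
        then show ?thesis by (simp add: nonpos h_def)
      next
        case 2
        then have "x powr d \<le> 1"
          using \<open>0 < d\<close> by (intro powr_le1) auto
        then have "K * x powr d \<le> K"
          using K(1) by (rule mult_left_le)
        then have "\<bar>RL_integral d g x\<bar> \<le> K"
          using near[OF 2(1)] by (simp add: K_def)
        then have "\<bar>RL_integral d g x\<bar> powr \<alpha> \<le> K powr \<alpha>"
          using \<open>0 < \<alpha>\<close> by (intro powr_mono2) auto
        with 2 show ?thesis by (simp add: h_def)
      next
        case 3
        have "\<bar>RL_integral d g x\<bar> powr \<alpha> \<le> (K' * x powr (d - 1)) powr \<alpha>"
          using far[OF 3] \<open>0 < \<alpha>\<close> unfolding K'_def by (intro powr_mono2) auto
        also have "\<dots> = K' powr \<alpha> * x powr ((d - 1) * \<alpha>)"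
          using K by (simp add: powr_mult powr_powr)
        also have "\<dots> \<le> h x"
          using 3 by (simp add: h_def)
        finally show ?thesis .
      qed
    qed
    then show "AE x in lebesgue. norm (\<bar>RL_integral d g x\<bar> powr \<alpha>) \<le> norm (h x)"
      by (intro AE_I2) (simp add: order.trans[OF _ abs_ge_self])
  qed
qed

section \<open>Linear combinations of stable integrals and stationarity\<close>

lemma Lspace_lincomb:
  assumes "0 < \<alpha>" "f \<in> Lspace \<alpha>" "g \<in> Lspace \<alpha>"
  shows "(\<lambda>x. a * f x + b * g x) \<in> Lspace \<alpha>"
proof -
  have [measurable]: "f \<in> borel_measurable lebesgue" "g \<in> borel_measurable lebesgue"
    using assms by (auto simp: Lspace_def)
  \<comment> \<open>Bounding the sum by twice the larger modulus gives a crude substitute for the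
    Minkowski inequality, enough for closure under addition.\<close>
  have powr_add_le: "\<bar>u + v\<bar> powr \<alpha> \<le> 2 powr \<alpha> * (\<bar>u\<bar> powr \<alpha> + \<bar>v\<bar> powr \<alpha>)" for u v :: real
  proof -
    have "\<bar>u + v\<bar> powr \<alpha> \<le> (2 * max \<bar>u\<bar> \<bar>v\<bar>) powr \<alpha>"
      using \<open>0 < \<alpha>\<close> by (intro powr_mono2) auto
    also have "\<dots> = 2 powr \<alpha> * max \<bar>u\<bar> \<bar>v\<bar> powr \<alpha>"
      by (simp add: powr_mult)
    also have "\<dots> \<le> 2 powr \<alpha> * (\<bar>u\<bar> powr \<alpha> + \<bar>v\<bar> powr \<alpha>)"
      by (intro mult_left_mono) (auto simp: max_def)
    finally show ?thesis .
  qed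
  have "integrable lebesgue (\<lambda>x. \<bar>a * f x + b * g x\<bar> powr \<alpha>)"
  proof (rule Bochner_Integration.integrable_bound)
    show "integrable lebesgue (\<lambda>x. 2 powr \<alpha> * (\<bar>a\<bar> powr \<alpha> * \<bar>f x\<bar> powr \<alpha> + \<bar>b\<bar> powr \<alpha> * \<bar>g x\<bar> powr \<alpha>))"
      using assms by (simp add: Lspace_def)
    show "AE x in lebesgue. norm (\<bar>a * f x + b * g x\<bar> powr \<alpha>)
        \<le> norm (2 powr \<alpha> * (\<bar>a\<bar> powr \<alpha> * \<bar>f x\<bar> powr \<alpha> + \<bar>b\<bar> powr \<alpha> * \<bar>g x\<bar> powr \<alpha>))"
      using powr_add_le[of "a * f x" "b * g x" for x]
      by (intro AE_I2) (simp add: abs_mult powr_mult)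
  qed measurable
  then show ?thesis
    by (simp add: Lspace_def)
qed

lemma Lspace_sum:
  assumes "0 < \<alpha>" "finite J" "\<And>i. i \<in> J \<Longrightarrow> f i \<in> Lspace \<alpha>"
  shows "(\<lambda>x. \<Sum>i\<in>J. \<theta> i * f i x) \<in> Lspace \<alpha>"
  using assms(2,3)
proof (induction J rule: finite_induct)
  case empty
  then show ?case by (simp add: Lspace_def)
next
  case (insert j J)
  then show ?case
    using Lspace_lincomb[OF \<open>0 < \<alpha>\<close>, of "f j" "\<lambda>x. \<Sum>i\<in>J. \<theta> i * f i x" "\<theta> j" 1] by simp
qed

lemma stable_integral_lincomb:
  assumes "stable_integral M \<alpha> L I" "f \<in> Lspace \<alpha>" "g \<in> Lspace \<alpha>"
  shows "AE w in M. I (\<lambda>x. a * f x + b * g x) w = a * I f w + b * I g w"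
  using assms unfolding stable_integral_def by blast

lemma stable_integral_sum:
  assumes SI: "stable_integral M \<alpha> L I" and "0 < \<alpha>" "finite J" "\<And>i. i \<in> J \<Longrightarrow> f i \<in> Lspace \<alpha>"
  shows "AE w in M. I (\<lambda>x. \<Sum>i\<in>J. \<theta> i * f i x) w = (\<Sum>i\<in>J. \<theta> i * I (f i) w)"
  using assms(3,4)
proof (induction J rule: finite_induct)
  case empty
  have "(\<lambda>_. 0) \<in> Lspace \<alpha>" by (simp add: Lspace_def)
  \<comment> \<open>Linearity with both coefficients 0 forces the integral of the zero function to
    vanish almost surely.\<close>
  then show ?case
    using stable_integral_lincomb[OF SI, of "\<lambda>_. 0" "\<lambda>_. 0" 0 0] by simp
next
  case (insert j J)
  have "(\<lambda>x. \<Sum>i\<in>J. \<theta> i * f i x) \<in> Lspace \<alpha>"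
    using insert by (intro Lspace_sum \<open>0 < \<alpha>\<close>) auto
  then have "AE w in M. I (\<lambda>x. \<theta> j * f j x + 1 * (\<Sum>i\<in>J. \<theta> i * f i x)) w
      = \<theta> j * I (f j) w + 1 * I (\<lambda>x. \<Sum>i\<in>J. \<theta> i * f i x) w"
    using insert.prems by (intro stable_integral_lincomb[OF SI]) auto
  then show ?case
    using insert.IH insert.hyps insert.prems by auto
qed

text \<open>Almost surely equal variables have the same law, so the sum of integrals may be replaced
  by the integral of the sum, whose characteristic function is prescribed.\<close>

lemma char_stable_integral_sum:
  assumes SI: "stable_integral M \<alpha> L I" and "0 < \<alpha>" "finite J" and f: "\<And>i. i \<in> J \<Longrightarrow> f i \<in> Lspace \<alpha>"
  shows "char (distr M borel (\<lambda>w. \<Sum>i\<in>J. \<theta> i * I (f i) w)) s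
    = complex_of_real (exp (- (\<bar>s\<bar> powr \<alpha> * (LINT x|lebesgue. \<bar>\<Sum>i\<in>J. \<theta> i * f i x\<bar> powr \<alpha>))))"
proof -
  let ?F = "\<lambda>x. \<Sum>i\<in>J. \<theta> i * f i x"
  have F: "?F \<in> Lspace \<alpha>"
    using assms by (intro Lspace_sum)
  have meas: "I h \<in> borel_measurable M" if "h \<in> Lspace \<alpha>" for h
    using SI that by (simp add: stable_integral_def)
  have "distr M borel (\<lambda>w. \<Sum>i\<in>J. \<theta> i * I (f i) w) = distr M borel (I ?F)"
  proof (rule distr_cong_AE)
    show "AE w in M. (\<Sum>i\<in>J. \<theta> i * I (f i) w) = I ?F w"
      using stable_integral_sum[OF SI \<open>0 < \<alpha>\<close> \<open>finite J\<close> f, where \<theta> = \<theta>]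
      by (rule eventually_mono[OF _ sym])
  qed (use meas f F in auto)
  with SI F show ?thesis
    by (simp add: stable_integral_def)
qed

lemma stable_integral_translates_stationary:
  assumes "prob_space M" and SI: "stable_integral M \<alpha> L I" and "0 < \<alpha>"
    and k: "\<And>t. k t \<in> Lspace \<alpha>" and shift: "\<And>t h x. k (t + h) (x + h) = k t x"
  shows "stationary_process M (\<lambda>t. I (k t))"
  unfolding stationary_process_def
proof (intro conjI allI impI)
  show meas: "I (k t) \<in> borel_measurable M" for t
    using SI k by (simp add: stable_integral_def)
  fix h :: real and J :: "real set"
  assume "finite J"
  show "distr M (PiM J (\<lambda>_. borel)) (\<lambda>w. \<lambda>t\<in>J. I (k (t + h)) w)
      = distr M (PiM J (\<lambda>_. borel)) (\<lambda>w. \<lambda>t\<in>J. I (k t) w)"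
  proof (rule Cramer_Wold)
    fix \<theta> :: "real \<Rightarrow> real"
    \<comment> \<open>Lebesgue measure is translation invariant; after the substitution, covariance
      of the kernels removes \<open>h\<close> from the integrand.\<close>
    have "(LINT x|lebesgue. \<bar>\<Sum>t\<in>J. \<theta> t * k (t + h) x\<bar> powr \<alpha>)
        = (LINT x|lebesgue. \<bar>\<Sum>t\<in>J. \<theta> t * k (t + h) (x + h)\<bar> powr \<alpha>)"
      by (subst lebesgue_integral_real_affine[of 1 _ h]) (simp_all add: add.commute)
    then show "char (distr M borel (\<lambda>w. \<Sum>t\<in>J. \<theta> t * I (k (t + h)) w)) 1
        = char (distr M borel (\<lambda>w. \<Sum>t\<in>J. \<theta> t * I (k t) w)) 1"
      using char_stable_integral_sum[OF SI \<open>0 < \<alpha>\<close> \<open>finite J\<close>] k by (simp add: shift)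
  qed (use assms meas \<open>finite J\<close> in auto)
qed

theorem theorem4p1:
  fixes M :: "'w measure"
    and L :: "real \<Rightarrow> 'w \<Rightarrow> real"
    and I :: "(real \<Rightarrow> real) \<Rightarrow> 'w \<Rightarrow> real"
    and \<alpha> d C c :: real
    and g :: "real \<Rightarrow> real"
  assumes "prob_space M"
    and "1 < \<alpha>" and "\<alpha> < 2"
    and "SaS_process M \<alpha> L"
    and "stable_integral M \<alpha> L I"
    and "0 < d" and "d < 1 - 1 / \<alpha>"
    and "g \<in> borel_measurable lebesgue"
    and "\<And>t. t < 0 \<Longrightarrow> g t = 0"
    and "C > 0" and "c > 0"
    and "\<And>t. \<bar>g t\<bar> \<le> C * exp (- c * t)"
  shows "(\<forall>x. set_integrable lebesgue {..x} (RL_integrand d g x)) \<and>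
         (\<forall>t. FIMA_kernel d g t \<in> Lspace \<alpha>) \<and>
         stationary_process M (FIMA I d g)"
proof -
  have "0 < \<alpha>" "0 < 1 / \<alpha>" using \<open>1 < \<alpha>\<close> by simp_all
  then have "d \<le> 1" using \<open>d < 1 - 1 / \<alpha>\<close> by linarith
  note [measurable] = RL_integral_measurable[OF assms(8), of d]
  \<comment> \<open>Because the fractional integral vanishes on nonpositive arguments, the kernel is
    a function of \<open>t - x\<close> alone, which makes it translation covariant.\<close>
  have kernel_eq: "FIMA_kernel d g t x = RL_integral d g (t - x)" for t x
  proof -
    have "RL_integral d g (t - x) = 0" if "t - x \<le> 0"
      by (rule RL_integral_nonpos[where C = C and c = c]) (fact | rule assms)+
    then show ?thesis
      by (auto simp: FIMA_kernel_def indicator_def)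
  qed
  have kernel: "FIMA_kernel d g t \<in> Lspace \<alpha>" for t
  proof -
    have "FIMA_kernel d g t \<in> borel_measurable lebesgue"
      unfolding kernel_eq[abs_def] by (rule measurable_completion) measurable
    moreover have "integrable lebesgue (\<lambda>x. \<bar>RL_integral d g x\<bar> powr \<alpha>)"
      by (rule RL_integral_powr_integrable[where C = C and c = c]) (fact | rule assms)+
    then have "integrable lebesgue (\<lambda>x. \<bar>RL_integral d g (t + - 1 * x)\<bar> powr \<alpha>)"
      by (rule lebesgue_integrable_real_affine) simp
    ultimately show ?thesis
      by (simp add: Lspace_def kernel_eq)
  qed
  have "stationary_process M (FIMA I d g)"
    unfolding FIMA_def[abs_def]
    by (rule stable_integral_translates_stationary[OF assms(1,5) \<open>0 < \<alpha>\<close> kernel])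
       (simp add: kernel_eq)
  \<comment> \<open>The Bochner integral of a nonintegrable function is 0 by default; this clause
    ensures that \<open>RL_integral\<close> is a genuine integral at every point.\<close>
  moreover have "set_integrable lebesgue {..x} (RL_integrand d g x)" for x
    by (rule RL_integrand_integrable[where C = C and c = c]) (fact | rule assms)+
  ultimately show ?thesis
    using kernel by blast
qed

end
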